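(* Let $\mathcal{H}$ be a Hilbert space of finite dimension $d$, let $P$ be a physical property of states in $\mathcal{D}(\mathcal{H})$, let $\mathscr{C}\subseteq\mathcal{D}(\mathcal{H})$ be the set of all states that lack $P$, let $\widehat{A}$ be an observable on $\mathcal{H}$, let $S'\in[0,\log_2 d]$, and let $$A_{\min,\mathscr{C},S'} := \min_{\rho\in\mathscr{C},\ S(\rho)\ge S'}\operatorname{Tr}[\rho\widehat{A}].$$ If a state $\xi\in\mathcal{D}(\mathcal{H})$ with $S(\xi)\ge S'$ satisfies $\operatorname{Tr}[\xi\widehat{A}]<A_{\min,\mathscr{C},S'}$, then $\xi$ has the property $P$. That is, the operator $Z^{\mathrm{PW}}_{S'}:=\widehat{A}-A_{\min,\mathscr{C},S'}\,\mathbb{1}$ acts as a proxy witness operator for $P$ among states of entropy at least $S'$.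
   Context: $\mathcal{D}(\mathcal{H})$ is the set of density operators on $\mathcal{H}$. A property $P$ is identified with a partition of $\mathcal{D}(\mathcal{H})$ into the set $\mathscr{C}$ of states lacking $P$ and its complement of states having $P$. $S(\rho)=-\operatorname{Tr}[\rho\log_2\rho]$ is the von Neumann entropy. An observable is a Hermitian operator; the minimum defining $A_{\min,\mathscr{C},S'}$ is assumed to exist. "Proxy witness among states of entropy at least $S'$" means: $\operatorname{Tr}[\rho Z^{\mathrm{PW}}_{S'}]\ge 0$ for all $\rho\in\mathscr{C}$ with $S(\rho)\ge S'$, and any state $\xi$ with $S(\xi)\ge S'$ and $\operatorname{Tr}[\xi Z^{\mathrm{PW}}_{S'}]<0$ has the property $P$. *)

theory Defs
  imports "HOL-Analysis.Analysis"
begin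

text \<open>
  The Hilbert space of finite dimension \<open>d\<close> is \<open>complex ^ 'n\<close> with its standard inner product and
  \<open>d = CARD('n)\<close>; operators are given by their matrices in the standard orthonormal basis.
\<close>

type_synonym 'n operator = "complex ^ 'n ^ 'n"

definition cinner :: "complex ^ 'n::finite \<Rightarrow> complex ^ 'n \<Rightarrow> complex" where
  "cinner v w = (\<Sum>i\<in>UNIV. cnj (v $ i) * w $ i)"

definition dagger :: "'n::finite operator \<Rightarrow> 'n operator" where
  "dagger A = (\<chi> i j. cnj (A $ j $ i))"

definition hermitian :: "'n::finite operator \<Rightarrow> bool" where
  "hermitian A \<longleftrightarrow> dagger A = A"

text \<open>For Hermitian \<open>A\<close> the quadratic form is real, so taking the real part loses nothing.\<close>

definition positive_semidefinite :: "'n::finite operator \<Rightarrow> bool" where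
  "positive_semidefinite A \<longleftrightarrow> hermitian A \<and> (\<forall>v. 0 \<le> Re (cinner v (A *v v)))"

definition density_operators :: "'n::finite operator set" where
  "density_operators = {\<rho>. positive_semidefinite \<rho> \<and> trace \<rho> = 1}"

text \<open>
  Functional calculus for a Hermitian operator \<open>A\<close>: \<open>f(A)\<close> is the operator that acts as the scalar
  \<open>f \<mu>\<close> on the eigenspace of \<open>A\<close> for each eigenvalue \<open>\<mu>\<close>. It exists and is unique because \<open>A\<close> is
  unitarily diagonalizable; see \<open>operator_function_diagonal\<close> below.
\<close>

definition operator_function :: "(real \<Rightarrow> real) \<Rightarrow> 'n::finite operator \<Rightarrow> 'n operator" where
  "operator_function f A =
    (THE B. \<forall>\<mu> v. A *v v = complex_of_real \<mu> *s v \<longrightarrow> B *v v = complex_of_real (f \<mu>) *s v)"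

text \<open>
  Since \<open>log 2 0 = 0\<close> in HOL, the kernel of \<open>\<rho>\<close> contributes nothing, in accordance with the usual
  convention \<open>0 log 0 = 0\<close>. The trace is real; see \<open>von_neumann_entropy_diagonal\<close> below.
\<close>

definition von_neumann_entropy :: "'n::finite operator \<Rightarrow> real" where
  "von_neumann_entropy \<rho> = - Re (trace (\<rho> ** operator_function (log 2) \<rho>))"

text \<open>For Hermitian arguments the trace is real; see \<open>trace_mult_hermitian_real\<close> below.\<close>

definition expectation_value :: "'n::finite operator \<Rightarrow> 'n operator \<Rightarrow> real" where
  "expectation_value \<rho> A = Re (trace (\<rho> ** A))"

text \<open>
  A property is a predicate on operators, of which only the values on density operators matter.
\<close>

definition states_lacking :: "('n::finite operator \<Rightarrow> bool) \<Rightarrow> 'n operator set" where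
  "states_lacking P = {\<rho> \<in> density_operators. \<not> P \<rho>}"

definition A_min :: "'n::finite operator \<Rightarrow> 'n operator set \<Rightarrow> real \<Rightarrow> real" where
  "A_min A C S' =
    (LEAST x. x \<in> {expectation_value \<rho> A | \<rho>. \<rho> \<in> C \<and> von_neumann_entropy \<rho> \<ge> S'})"

definition A_min_exists :: "'n::finite operator \<Rightarrow> 'n operator set \<Rightarrow> real \<Rightarrow> bool" where
  "A_min_exists A C S' \<longleftrightarrow>
    (\<exists>\<rho>. \<rho> \<in> C \<and> von_neumann_entropy \<rho> \<ge> S' \<and>
      (\<forall>\<sigma>. \<sigma> \<in> C \<and> von_neumann_entropy \<sigma> \<ge> S' \<longrightarrow> expectation_value \<rho> A \<le> expectation_value \<sigma> A))"

definition proxy_witness :: "('n::finite operator \<Rightarrow> bool) \<Rightarrow> real \<Rightarrow> 'n operator \<Rightarrow> bool" where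
  "proxy_witness P S' Z \<longleftrightarrow>
    (\<forall>\<rho> \<in> states_lacking P. von_neumann_entropy \<rho> \<ge> S' \<longrightarrow> expectation_value \<rho> Z \<ge> 0) \<and>
    (\<forall>\<xi> \<in> density_operators.
      von_neumann_entropy \<xi> \<ge> S' \<longrightarrow> expectation_value \<xi> Z < 0 \<longrightarrow> P \<xi>)"

lemma trace_mult_hermitian_real:
  assumes "hermitian A" "hermitian B"
  shows "Im (trace (A ** B)) = 0"
proof -
  have *: "cnj (M $ i $ j) = M $ j $ i" if "hermitian M" for M :: "'a operator" and i j
    using that unfolding hermitian_def dagger_def by (metis vec_lambda_beta)
  have "cnj (trace (A ** B)) = (\<Sum>i\<in>UNIV. \<Sum>k\<in>UNIV. B $ i $ k * A $ k $ i)"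
    unfolding trace_def matrix_matrix_mult_def
    by (simp add: *[OF assms(1)] *[OF assms(2)] mult.commute)
  also have "\<dots> = trace (B ** A)"
    by (simp add: trace_def matrix_matrix_mult_def)
  also have "\<dots> = trace (A ** B)" by (rule trace_mul_sym)
  finally show ?thesis by (simp add: complex_eq_iff)
qed

definition diagonal :: "('n \<Rightarrow> real) \<Rightarrow> 'n::finite operator" where
  "diagonal a = (\<chi> i j. if i = j then complex_of_real (a i) else 0)"

lemma diagonal_mult_vec: "(diagonal a *v v) $ i = complex_of_real (a i) * v $ i"
  by (simp add: diagonal_def matrix_vector_mult_def if_distrib[of "\<lambda>x. x * _"] cong: if_cong)

lemma operator_function_diagonal:
  assumes U: "U ** dagger U = mat 1" "dagger U ** U = mat 1"
    and A: "A = U ** diagonal a ** dagger U"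
  shows "operator_function f A = U ** diagonal (\<lambda>i. f (a i)) ** dagger U"
  unfolding operator_function_def
proof (rule the_equality)
  let ?L = "U ** diagonal (\<lambda>i. f (a i)) ** dagger U"
  show "\<forall>\<mu> v. A *v v = complex_of_real \<mu> *s v \<longrightarrow> ?L *v v = complex_of_real (f \<mu>) *s v"
  proof (intro allI impI)
    fix \<mu> v assume v: "A *v v = complex_of_real \<mu> *s v"
    define w where "w = dagger U *v v"
    have "diagonal a *v w = dagger U *v (A *v v)"
      unfolding w_def A by (simp only: matrix_vector_mul_assoc matrix_mul_assoc U matrix_mul_lid)
    also have "\<dots> = complex_of_real \<mu> *s w"
      unfolding v w_def by (simp add: vector_scalar_commute)
    finally have e: "complex_of_real (a i) * w $ i = complex_of_real \<mu> * w $ i" for i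
      by (simp add: vec_eq_iff diagonal_mult_vec)
    have "complex_of_real (f (a i)) * w $ i = complex_of_real (f \<mu>) * w $ i" for i
      using e[of i] by (cases "w $ i = 0") auto
    then have "diagonal (\<lambda>i. f (a i)) *v w = complex_of_real (f \<mu>) *s w"
      by (simp add: vec_eq_iff diagonal_mult_vec)
    then have "?L *v v = U *v (complex_of_real (f \<mu>) *s w)"
      unfolding w_def by (simp only: matrix_vector_mul_assoc[symmetric])
    also have "\<dots> = complex_of_real (f \<mu>) *s v"
      unfolding w_def by (simp only: vector_scalar_commute matrix_vector_mul_assoc U matrix_vector_mul_lid)
    finally show "?L *v v = complex_of_real (f \<mu>) *s v" .
  qed
next
  let ?L = "U ** diagonal (\<lambda>i. f (a i)) ** dagger U"
  fix B assume B: "\<forall>\<mu> v. A *v v = complex_of_real \<mu> *s v \<longrightarrow> B *v v = complex_of_real (f \<mu>) *s v"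
  have ax: "diagonal b *v axis i 1 = complex_of_real (b i) *s axis i 1" for b and i :: 'a
    by (simp add: vec_eq_iff diagonal_mult_vec axis_def)
  have col: "(U ** diagonal b ** dagger U) *v (U *v axis i 1) = complex_of_real (b i) *s (U *v axis i 1)"
    for b i
  proof -
    have "(U ** diagonal b ** dagger U) *v (U *v axis i 1) = U *v (diagonal b *v axis i 1)"
      by (simp only: matrix_vector_mul_assoc matrix_mul_assoc[symmetric] U matrix_mul_rid)
    then show ?thesis by (simp only: ax vector_scalar_commute)
  qed
  have "(B ** U) *v axis i 1 = (?L ** U) *v axis i 1" for i
    using B[rule_format, of "U *v axis i 1" "a i"] col[of a i] col[of "\<lambda>i. f (a i)" i]
    by (simp only: A matrix_vector_mul_assoc)
  moreover have "(M *v axis i 1) $ k = M $ k $ i" for M :: "'a operator" and i k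
    by (simp add: matrix_vector_mult_def axis_def if_distrib[of "\<lambda>x. _ * x"] cong: if_cong)
  ultimately have "B ** U = ?L ** U" by (metis vec_eq_iff)
  then have "B ** (U ** dagger U) = ?L ** (U ** dagger U)" by (simp only: matrix_mul_assoc)
  then show "B = ?L" by (simp add: U)
qed

lemma von_neumann_entropy_diagonal:
  assumes U: "U ** dagger U = mat 1" "dagger U ** U = mat 1"
    and \<rho>: "\<rho> = U ** diagonal a ** dagger U"
  shows "trace (\<rho> ** operator_function (log 2) \<rho>) = complex_of_real (\<Sum>i\<in>UNIV. a i * log 2 (a i))"
    and "von_neumann_entropy \<rho> = - (\<Sum>i\<in>UNIV. a i * log 2 (a i))"
proof -
  let ?D = "diagonal a" and ?L = "diagonal (\<lambda>i. log 2 (a i))"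
  have "\<rho> ** operator_function (log 2) \<rho> = U ** ?D ** (dagger U ** U) ** ?L ** dagger U"
    unfolding operator_function_diagonal[OF U \<rho>] by (simp only: \<rho> matrix_mul_assoc)
  also have "\<dots> = U ** (?D ** ?L ** dagger U)" by (simp only: U matrix_mul_assoc matrix_mul_rid)
  finally have "trace (\<rho> ** operator_function (log 2) \<rho>) = trace (?D ** ?L ** dagger U ** U)"
    by (metis trace_mul_sym)
  also have "\<dots> = trace (?D ** ?L)" by (simp only: matrix_mul_assoc[symmetric] U matrix_mul_rid)
  also have "\<dots> = complex_of_real (\<Sum>i\<in>UNIV. a i * log 2 (a i))"
    by (simp add: trace_def matrix_matrix_mult_def diagonal_def if_distrib[of "\<lambda>x. x * _"] cong: if_cong)
  finally show *: "trace (\<rho> ** operator_function (log 2) \<rho>)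
    = complex_of_real (\<Sum>i\<in>UNIV. a i * log 2 (a i))" .
  show "von_neumann_entropy \<rho> = - (\<Sum>i\<in>UNIV. a i * log 2 (a i))"
    unfolding von_neumann_entropy_def * by simp
qed

end

theory Submission
  imports Defs
begin

text \<open>A state that lacks \<open>P\<close> and has entropy at least \<open>S'\<close> competes
  in the minimum, so its expectation value is at least \<open>A_min\<close>
  (\<open>A_min_le\<close>); a state of such entropy lying strictly below \<open>A_min\<close> must
  therefore have \<open>P\<close>. As states have trace 1, subtracting \<open>A_min\<close> times
  the identity lowers each expectation value by exactly \<open>A_min\<close>
  (\<open>expectation_value_shift\<close>), so the sign of the new value records this
  comparison.\<close>

lemma expectation_value_shift:
  assumes "\<rho> \<in> density_operators"
  shows "expectation_value \<rho> (A - a *\<^sub>R mat 1) = expectation_value \<rho> A - a"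
proof -
  have "\<rho> ** (A - a *\<^sub>R mat 1) = \<rho> ** A - a *\<^sub>R \<rho>"
    \<comment> \<open>Pushing products into the \<open>if\<close> of the entries of
      \<open>mat 1\<close> collapses the sum over the middle index to one term.\<close>
    by (simp add: vec_eq_iff matrix_matrix_mult_def mat_def right_diff_distrib sum_subtractf
        if_distrib[of "\<lambda>x. _ * x"] if_distrib[of "\<lambda>x. a *\<^sub>R x"] cong: if_cong)
  moreover have "trace (a *\<^sub>R \<rho>) = a *\<^sub>R trace \<rho>"
    by (simp add: trace_def scaleR_sum_right)
  moreover have "trace \<rho> = 1"
    using assms by (simp add: density_operators_def)
  ultimately show ?thesis
    by (simp add: expectation_value_def trace_sub)
qed

text \<open>\<open>LEAST\<close> on the reals is informative only if a least element exists; the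
  minimizer given by \<open>A_min_exists\<close> provides one, and \<open>A_min\<close> is its
  expectation value.\<close>

lemma A_min_le:
  assumes "A_min_exists A C S'" "\<rho> \<in> C" "von_neumann_entropy \<rho> \<ge> S'"
  shows "A_min A C S' \<le> expectation_value \<rho> A"
proof -
  obtain \<rho>\<^sub>0 where "\<rho>\<^sub>0 \<in> C" "von_neumann_entropy \<rho>\<^sub>0 \<ge> S'"
    and min: "\<And>\<sigma>. \<sigma> \<in> C \<Longrightarrow> von_neumann_entropy \<sigma> \<ge> S' \<Longrightarrow>
      expectation_value \<rho>\<^sub>0 A \<le> expectation_value \<sigma> A"
    using assms(1) unfolding A_min_exists_def by blast
  then have "A_min A C S' = expectation_value \<rho>\<^sub>0 A"
    unfolding A_min_def by (intro Least_equality) auto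
  with min assms(2,3) show ?thesis by simp
qed

theorem corollary2:
  fixes P :: "'n::finite operator \<Rightarrow> bool"
    and C :: "'n operator set"
    and A :: "'n operator"
    and S' :: real
  assumes "C = states_lacking P"
    and "hermitian A"
    and "S' \<in> {0 .. log 2 (real CARD('n))}"
    and "A_min_exists A C S'"
  shows "(\<forall>\<xi> \<in> density_operators.
            von_neumann_entropy \<xi> \<ge> S' \<longrightarrow> expectation_value \<xi> A < A_min A C S' \<longrightarrow> P \<xi>)
       \<and> proxy_witness P S' (A - A_min A C S' *\<^sub>R mat 1)"
proof -
  have le: "A_min A C S' \<le> expectation_value \<rho> A"
    if "\<rho> \<in> density_operators" "\<not> P \<rho>" "von_neumann_entropy \<rho> \<ge> S'" for \<rho>
    using A_min_le[OF assms(4)] that assms(1) by (simp add: states_lacking_def)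
  then have "P \<xi>" if "\<xi> \<in> density_operators" "von_neumann_entropy \<xi> \<ge> S'"
    "expectation_value \<xi> A < A_min A C S'" for \<xi>
    using that by (meson not_le)
  \<comment> \<open>After the shift, nonnegativity on states lacking \<open>P\<close> is
    \<open>le\<close>, and detection by a negative value is its contrapositive.\<close>
  with le show ?thesis
    by (auto simp: proxy_witness_def states_lacking_def expectation_value_shift)
qed

end
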